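(* Let $\mathfrak{g}$ be a symmetrizable Kac–Moody Lie algebra and $m\geq2$ an integer. Let $\phi_m:W(\mathfrak{g})\to\Gamma_{\boldsymbol{s}_m(\mathfrak{g})}$ be the group embedding of the Weyl group of $\mathfrak{g}$ into the cluster modular group of the mutation class $\boldsymbol{s}_m(\mathfrak{g})$ of the quiver $Q_m(\mathfrak{g})$. Then for any finite subgroup $G\subset W(\mathfrak{g})$, the group $\phi_m(G)$ has a fixed point in $\mathcal{A}_{\boldsymbol{s}_m(\mathfrak{g})}(\mathbb{R}_{>0})$.
   Context: Seeds. Fix a finite set $I$ and positive integers $(d_i)_{i\in I}$. Let $\mathcal{F}_A,\mathcal{F}_X$ be fields isomorphic to the rational function field over $\mathbb{Q}$ in $|I|$ variables. A seed $\mathbf{i}=(\varepsilon,\mathbf{A},\mathbf{X})$ consists of an integer matrix $\varepsilon=(\varepsilon_{ij})_{i,j\in I}$ (exchange matrix) with $(\varepsilon_{ij}d_j)$ skew-symmetric, a tuple $\mathbf{A}=(A_i)_{i\in I}$ of free generators of the field $\mathcal{F}_A$ and a tuple $\mathbf{X}=(X_i)_{i\in I}$ of free generators of $\mathcal{F}_X$. With $[x]_+=\max\{x,0\}$, the mutation $\mu_k(\mathbf{i})=(\varepsilon',\mathbf{A}',\mathbf{X}')$, $k\in I$, is given by: $\varepsilon'_{ij}=-\varepsilon_{ij}$ if $i=k$ or $j=k$, and $\varepsilon'_{ij}=\varepsilon_{ij}+[\varepsilon_{ik}]_+[\varepsilon_{kj}]_+-[-\varepsilon_{ik}]_+[-\varepsilon_{kj}]_+$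 otherwise; $A'_k=A_k^{-1}\big(\prod_j A_j^{[\varepsilon_{kj}]_+}+\prod_j A_j^{[-\varepsilon_{kj}]_+}\big)$, $A'_i=A_i$ for $i\ne k$; $X'_k=X_k^{-1}$, $X'_i=X_i(1+X_k^{-\mathrm{sgn}(\varepsilon_{ik})})^{-\varepsilon_{ik}}$ for $i\neq k$. Two seeds are mutation-equivalent if related by a sequence of mutations and simultaneous relabelings by permutations of $I$; an equivalence class $\boldsymbol{s}$ is a mutation class. Cluster manifold and modular group. $\mathcal{A}_{\boldsymbol{s}}(\mathbb{R}_{>0})$ is the real-analytic manifold with global charts $\psi_{\mathbf{i}}=(A_j^{\mathbf{i}})_{j}:\mathcal{A}_{\boldsymbol{s}}(\mathbb{R}_{>0})\xrightarrow{\sim}\mathbb{R}_{>0}^I$, $\mathbf{i}\in\boldsymbol{s}$, whose transition maps for $\mathbf{i}'=\mu_k(\mathbf{i})$ are given by $A_k^{\mathbf{i}'}=(A_k^{\mathbf{i}})^{-1}\big(\prod_j (A_j^{\mathbf{i}})^{[\varepsilon^{\mathbf{i}}_{kj}]_+}+\prod_j (A_j^{\mathbf{i}})^{[-\varepsilon^{\mathbf{i}}_{kj}]_+}\big)$, $A_i^{\mathbf{i}'}=A_i^{\mathbf{i}}$ for $i\ne k$ (and by permutations of coordinates for relabelings), where $\varepsilon^{\mathbf{i}},A_j^{\mathbf{i}}$ denote the data of $\mathbf{i}$. $\Gamma_{\boldsymbol{s}}$ is the group of permutations $\phi$ of the set $\boldsymbol{s}$ of seeds that preserve exchange matrices and commute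 with all mutations and relabelings. It acts on $\mathcal{A}_{\boldsymbol{s}}(\mathbb{R}_{>0})$ by $A_j^{\mathbf{i}}(\phi(g))=A_j^{\phi^{-1}(\mathbf{i})}(g)$; this action is known to be faithful. Write $\phi^*F=F\circ\phi$. Weyl group. Let $C=(C_{su})_{s,u\in S}$ be the (symmetrizable, generalized) Cartan matrix of $\mathfrak{g}$, $S$ the finite vertex set of the Dynkin diagram. $W(\mathfrak{g})=\langle r_s\ (s\in S)\mid (r_sr_u)^{m_{su}}=1\rangle$ with $m_{ss}=1$ and, for $s\ne u$, $m_{su}=2,3,4,6,\infty$ according to $C_{su}C_{us}=0,1,2,3,\geq4$. The quiver $Q_m(\mathfrak{g})$. Choose a Coxeter quiver: an integer matrix $(\varepsilon_{su})_{s,u\in S}$ with $\varepsilon_{ss}=0$, $|\varepsilon_{su}|=-C_{us}$ for $s\neq u$, and $\varepsilon_{su},\varepsilon_{us}$ of opposite signs when nonzero (so it is skew-symmetrizable). $Q_m(\mathfrak{g})$ has vertex set $I=\{v_i^s\mid i\in\mathbb{Z}/m\mathbb{Z},\ s\in S\}$; its exchange matrix is the sum of the following contributions (all other entries $0$; for $m=2$ contributions to the same entry are added): for each $i$ and $s$, $+1$ to $\varepsilon_{v_i^s,v_{i+1}^s}$ and $-1$ to $\varepsilon_{v_{i+1}^s,v_i^s}$; for each $i$ and $s\ne u$, $\varepsilon_{su}$ to $\varepsilon_{v_i^s,v_i^u}$, $-[\varepsilon_{su}]_+$ to $\varepsilon_{v_i^s,v_{i+1}^u}$, and $[-\varepsilon_{su}]_+$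 to $\varepsilon_{v_i^s,v_{i-1}^u}$. $\boldsymbol{s}_m(\mathfrak{g})$ is the mutation class of a seed with this exchange matrix; let $A_j^u$ be the cluster variable of this initial seed at $v_j^u$. The embedding $\phi_m$ (Inoue–Ishibashi–Oya). There is an injective group homomorphism $\phi_m:W(\mathfrak{g})\to\Gamma_{\boldsymbol{s}_m(\mathfrak{g})}$ determined by $$\phi_m(r_s)^*A_j^u=\begin{cases}P_s\cdot A_j^u & u=s,\\ A_j^u & u\ne s,\end{cases}\qquad P_s=\sum_{j\in\mathbb{Z}/m\mathbb{Z}}\frac{1}{A_j^sA_{j+1}^s}\prod_{u\in S}(A_j^u)^{[-\varepsilon_{su}]_+}(A_{j+1}^u)^{[\varepsilon_{su}]_+}.$$ *)

theory Defs
  imports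
    Complex_Main
    "HOL-Library.FuncSet"
    "HOL-Library.Extended_Nat"
    "HOL-Combinatorics.Permutations"
    "HOL-Algebra.Bij"
begin

section \<open>Seeds and mutations\<close>

text \<open>
  The base field is the prime field, the rationals. A type of class \<open>field_char_0\<close> that possesses a
  tuple of free generators indexed by \<open>I\<close> is isomorphic to the field of rational functions over the
  rationals in the variables \<open>I\<close>.
\<close>

inductive_set generated_subfield :: "'f::field_char_0 set \<Rightarrow> 'f set" for B :: "'f set" where
  incl: "x \<in> B \<Longrightarrow> x \<in> generated_subfield B"
| one: "1 \<in> generated_subfield B"
| diff: "x \<in> generated_subfield B \<Longrightarrow> y \<in> generated_subfield B \<Longrightarrow> x - y \<in> generated_subfield B"
| mult: "x \<in> generated_subfield B \<Longrightarrow> y \<in> generated_subfield B \<Longrightarrow> x * y \<in> generated_subfield B"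
| inverse: "x \<in> generated_subfield B \<Longrightarrow> inverse x \<in> generated_subfield B"

text \<open>
  A polynomial in the variables \<open>I\<close> is a coefficient function \<open>c\<close> on a finite set \<open>N\<close> of exponent
  vectors.
\<close>

definition alg_independent :: "'i set \<Rightarrow> ('i \<Rightarrow> 'f::field_char_0) \<Rightarrow> bool" where
  "alg_independent I A \<longleftrightarrow>
     (\<forall>N (c :: ('i \<Rightarrow> nat) \<Rightarrow> rat). finite N \<longrightarrow> N \<subseteq> (I \<rightarrow>\<^sub>E UNIV) \<longrightarrow>
        (\<Sum>n\<in>N. of_rat (c n) * (\<Prod>i\<in>I. A i ^ n i)) = 0 \<longrightarrow> (\<forall>n\<in>N. c n = 0))"

definition free_generators :: "'i set \<Rightarrow> ('i \<Rightarrow> 'f::field_char_0) \<Rightarrow> bool" where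
  "free_generators I A \<longleftrightarrow> alg_independent I A \<and> generated_subfield (A ` I) = UNIV"

record ('i, 'a, 'x) seed =
  exch :: "'i \<Rightarrow> 'i \<Rightarrow> int"
  clA :: "'i \<Rightarrow> 'a"
  clX :: "'i \<Rightarrow> 'x"

text \<open>
  Matrices are extended by zero and tuples by \<^const>\<open>undefined\<close> outside the index set, so that equality
  of seeds is equality of the data indexed by \<open>I\<close>.
\<close>

definition is_seed ::
  "'i set \<Rightarrow> ('i \<Rightarrow> nat) \<Rightarrow> ('i, 'a::field_char_0, 'x::field_char_0) seed \<Rightarrow> bool" where
  "is_seed I d \<ii> \<longleftrightarrow>
     (\<forall>i\<in>I. \<forall>j\<in>I. exch \<ii> i j * int (d j) = - (exch \<ii> j i * int (d i))) \<and>
     (\<forall>i j. i \<notin> I \<or> j \<notin> I \<longrightarrow> exch \<ii> i j = 0) \<and>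
     clA \<ii> \<in> extensional I \<and> free_generators I (clA \<ii>) \<and>
     clX \<ii> \<in> extensional I \<and> free_generators I (clX \<ii>)"

definition mutate_exch :: "'i \<Rightarrow> ('i \<Rightarrow> 'i \<Rightarrow> int) \<Rightarrow> 'i \<Rightarrow> 'i \<Rightarrow> int" where
  "mutate_exch k \<epsilon> i j =
     (if i = k \<or> j = k then - \<epsilon> i j
      else \<epsilon> i j + max (\<epsilon> i k) 0 * max (\<epsilon> k j) 0 - max (- \<epsilon> i k) 0 * max (- \<epsilon> k j) 0)"

text \<open>
  The exponent \<^term>\<open>nat x\<close> is the positive part of the integer \<open>x\<close>. The same formula serves for the
  cluster variables in the field and for the coordinate changes of the cluster manifold.
\<close>

definition mutate_A :: "'i set \<Rightarrow> ('i \<Rightarrow> 'i \<Rightarrow> int) \<Rightarrow> 'i \<Rightarrow> ('i \<Rightarrow> 'f::field) \<Rightarrow> 'i \<Rightarrow> 'f" where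
  "mutate_A I \<epsilon> k a =
     (\<lambda>i\<in>I. if i = k
       then inverse (a k) * ((\<Prod>j\<in>I. a j ^ nat (\<epsilon> k j)) + (\<Prod>j\<in>I. a j ^ nat (- \<epsilon> k j)))
       else a i)"

definition mutate_X :: "'i set \<Rightarrow> ('i \<Rightarrow> 'i \<Rightarrow> int) \<Rightarrow> 'i \<Rightarrow> ('i \<Rightarrow> 'f::field) \<Rightarrow> 'i \<Rightarrow> 'f" where
  "mutate_X I \<epsilon> k x =
     (\<lambda>i\<in>I. if i = k then inverse (x k)
       else x i * (1 + x k powi (- sgn (\<epsilon> i k))) powi (- \<epsilon> i k))"

definition mutate ::
  "'i set \<Rightarrow> 'i \<Rightarrow> ('i, 'a::field_char_0, 'x::field_char_0) seed \<Rightarrow> ('i, 'a, 'x) seed" where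
  "mutate I k \<ii> =
     \<lparr>exch = mutate_exch k (exch \<ii>),
      clA = mutate_A I (exch \<ii>) k (clA \<ii>),
      clX = mutate_X I (exch \<ii>) k (clX \<ii>)\<rparr>"

definition relabel :: "('i \<Rightarrow> 'i) \<Rightarrow> ('i, 'a, 'x) seed \<Rightarrow> ('i, 'a, 'x) seed" where
  "relabel \<sigma> \<ii> =
     \<lparr>exch = (\<lambda>i j. exch \<ii> (\<sigma> i) (\<sigma> j)), clA = clA \<ii> \<circ> \<sigma>, clX = clX \<ii> \<circ> \<sigma>\<rparr>"

text \<open>
  Mutations are involutions on seeds and relabelings are invertible, so the equivalence class of a
  seed is the set of seeds that can be reached from it.
\<close>

inductive_set mutation_class ::
  "'i set \<Rightarrow> ('i, 'a::field_char_0, 'x::field_char_0) seed \<Rightarrow> ('i, 'a, 'x) seed set"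
  for I :: "'i set" and \<ii>\<^sub>0 :: "('i, 'a, 'x) seed" where
  base: "\<ii>\<^sub>0 \<in> mutation_class I \<ii>\<^sub>0"
| mutate: "\<ii> \<in> mutation_class I \<ii>\<^sub>0 \<Longrightarrow> k \<in> I \<Longrightarrow> mutate I k \<ii> \<in> mutation_class I \<ii>\<^sub>0"
| relabel: "\<ii> \<in> mutation_class I \<ii>\<^sub>0 \<Longrightarrow> \<sigma> permutes I \<Longrightarrow> relabel \<sigma> \<ii> \<in> mutation_class I \<ii>\<^sub>0"


section \<open>Cluster manifold and cluster modular group\<close>

text \<open>
  The charts are global, so a point \<open>g\<close> is the compatible family of its coordinate vectors:
  \<open>g \<ii>\<close> is the image of the point under the chart of the seed \<open>\<ii>\<close>, and \<open>g \<ii> j\<close> is the value at the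
  point of the cluster coordinate of \<open>\<ii>\<close> with index \<open>j\<close>.
\<close>

definition cluster_manifold ::
  "'i set \<Rightarrow> ('i, 'a::field_char_0, 'x::field_char_0) seed set
     \<Rightarrow> (('i, 'a, 'x) seed \<Rightarrow> 'i \<Rightarrow> real) set" where
  "cluster_manifold I \<s> =
     {g \<in> \<s> \<rightarrow>\<^sub>E (I \<rightarrow>\<^sub>E {0<..}).
        (\<forall>\<ii>\<in>\<s>. \<forall>k\<in>I. g (mutate I k \<ii>) = mutate_A I (exch \<ii>) k (g \<ii>)) \<and>
        (\<forall>\<ii>\<in>\<s>. \<forall>\<sigma>. \<sigma> permutes I \<longrightarrow> g (relabel \<sigma> \<ii>) = g \<ii> \<circ> \<sigma>)}"

definition cluster_modular_group ::
  "'i set \<Rightarrow> ('i, 'a::field_char_0, 'x::field_char_0) seed set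
     \<Rightarrow> (('i, 'a, 'x) seed \<Rightarrow> ('i, 'a, 'x) seed) monoid" where
  "cluster_modular_group I \<s> = (BijGroup \<s>)
     \<lparr>carrier := {\<phi> \<in> Bij \<s>.
        (\<forall>\<ii>\<in>\<s>. exch (\<phi> \<ii>) = exch \<ii>) \<and>
        (\<forall>\<ii>\<in>\<s>. \<forall>k\<in>I. \<phi> (mutate I k \<ii>) = mutate I k (\<phi> \<ii>)) \<and>
        (\<forall>\<ii>\<in>\<s>. \<forall>\<sigma>. \<sigma> permutes I \<longrightarrow> \<phi> (relabel \<sigma> \<ii>) = relabel \<sigma> (\<phi> \<ii>))}\<rparr>"

definition modular_action ::
  "('i, 'a, 'x) seed set \<Rightarrow> (('i, 'a, 'x) seed \<Rightarrow> ('i, 'a, 'x) seed)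
     \<Rightarrow> (('i, 'a, 'x) seed \<Rightarrow> 'i \<Rightarrow> real) \<Rightarrow> ('i, 'a, 'x) seed \<Rightarrow> 'i \<Rightarrow> real" where
  "modular_action \<s> \<phi> g = (\<lambda>\<ii>\<in>\<s>. g (inv_into \<s> \<phi> \<ii>))"


section \<open>Groups given by generators and relations\<close>

text \<open>
  Words over \<open>S\<close> and formal inverses of its elements: \<open>(s, True)\<close> stands for the generator \<open>s\<close>,
  \<open>(s, False)\<close> for its inverse.
\<close>

type_synonym 's word = "('s \<times> bool) list"

inductive pres_eq :: "'s set \<Rightarrow> 's word set \<Rightarrow> 's word \<Rightarrow> 's word \<Rightarrow> bool"
  for S :: "'s set" and R :: "'s word set" where
  cancel: "s \<in> S \<Longrightarrow> pres_eq S R [(s, b), (s, \<not> b)] []"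
| relator: "w \<in> R \<Longrightarrow> pres_eq S R w []"
| refl: "w \<in> lists (S \<times> UNIV) \<Longrightarrow> pres_eq S R w w"
| sym: "pres_eq S R v w \<Longrightarrow> pres_eq S R w v"
| trans: "pres_eq S R u v \<Longrightarrow> pres_eq S R v w \<Longrightarrow> pres_eq S R u w"
| append: "pres_eq S R v v' \<Longrightarrow> pres_eq S R w w' \<Longrightarrow> pres_eq S R (v @ w) (v' @ w')"

definition word_class :: "'s set \<Rightarrow> 's word set \<Rightarrow> 's word \<Rightarrow> 's word set" where
  "word_class S R w = {v. pres_eq S R w v}"

definition presented_group :: "'s set \<Rightarrow> 's word set \<Rightarrow> 's word set monoid" where
  "presented_group S R =
     \<lparr>carrier = word_class S R ` lists (S \<times> UNIV),
      mult = (\<lambda>P Q. {w. \<exists>p\<in>P. \<exists>q\<in>Q. pres_eq S R (p @ q) w}),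
      one = word_class S R []\<rparr>"


section \<open>Cartan matrices, Weyl groups and the quivers\<close>

definition symmetrizable_gcm :: "'s set \<Rightarrow> ('s \<Rightarrow> 's \<Rightarrow> int) \<Rightarrow> bool" where
  "symmetrizable_gcm S C \<longleftrightarrow>
     (\<forall>s\<in>S. C s s = 2) \<and>
     (\<forall>s\<in>S. \<forall>u\<in>S. s \<noteq> u \<longrightarrow> C s u \<le> 0) \<and>
     (\<forall>s\<in>S. \<forall>u\<in>S. C s u = 0 \<longrightarrow> C u s = 0) \<and>
     (\<exists>c :: 's \<Rightarrow> nat. (\<forall>s\<in>S. 0 < c s) \<and>
        (\<forall>s\<in>S. \<forall>u\<in>S. int (c s) * C s u = int (c u) * C u s))"

definition coxeter_exponent :: "('s \<Rightarrow> 's \<Rightarrow> int) \<Rightarrow> 's \<Rightarrow> 's \<Rightarrow> enat" where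
  "coxeter_exponent C s u =
     (if s = u then 1
      else if C s u * C u s = 0 then 2
      else if C s u * C u s = 1 then 3
      else if C s u * C u s = 2 then 4
      else if C s u * C u s = 3 then 6
      else \<infinity>)"

definition weyl_relators :: "'s set \<Rightarrow> ('s \<Rightarrow> 's \<Rightarrow> int) \<Rightarrow> 's word set" where
  "weyl_relators S C =
     {concat (replicate n [(s, True), (u, True)]) | n s u.
        s \<in> S \<and> u \<in> S \<and> coxeter_exponent C s u = enat n}"

definition weyl_group :: "'s set \<Rightarrow> ('s \<Rightarrow> 's \<Rightarrow> int) \<Rightarrow> 's word set monoid" where
  "weyl_group S C = presented_group S (weyl_relators S C)"

definition weyl_generator :: "'s set \<Rightarrow> ('s \<Rightarrow> 's \<Rightarrow> int) \<Rightarrow> 's \<Rightarrow> 's word set" where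
  "weyl_generator S C s = word_class S (weyl_relators S C) [(s, True)]"

definition coxeter_quiver :: "'s set \<Rightarrow> ('s \<Rightarrow> 's \<Rightarrow> int) \<Rightarrow> ('s \<Rightarrow> 's \<Rightarrow> int) \<Rightarrow> bool" where
  "coxeter_quiver S C e \<longleftrightarrow>
     (\<forall>s\<in>S. e s s = 0) \<and>
     (\<forall>s\<in>S. \<forall>u\<in>S. s \<noteq> u \<longrightarrow> \<bar>e s u\<bar> = - C u s) \<and>
     (\<forall>s\<in>S. \<forall>u\<in>S. e s u \<noteq> 0 \<longrightarrow> sgn (e u s) = - sgn (e s u))"

text \<open>
  The pair \<open>(s, i)\<close> is the vertex in row \<open>s\<close> and column \<open>i\<close>; columns are residues modulo \<open>m\<close>,
  represented by the integers \<open>0, \<dots>, m - 1\<close>.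
\<close>

definition Q_vertices :: "'s set \<Rightarrow> nat \<Rightarrow> ('s \<times> int) set" where
  "Q_vertices S m = S \<times> {0..<int m}"

definition Q_exch ::
  "'s set \<Rightarrow> ('s \<Rightarrow> 's \<Rightarrow> int) \<Rightarrow> nat \<Rightarrow> 's \<times> int \<Rightarrow> 's \<times> int \<Rightarrow> int" where
  "Q_exch S e m = (\<lambda>(s, i) (u, j).
     if (s, i) \<notin> Q_vertices S m \<or> (u, j) \<notin> Q_vertices S m then 0
     else if s = u then
       (if j = (i + 1) mod int m then 1 else 0) + (if i = (j + 1) mod int m then - 1 else 0)
     else
       (if j = i then e s u else 0) +
       (if j = (i + 1) mod int m then - max (e s u) 0 else 0) +
       (if j = (i - 1) mod int m then max (- e s u) 0 else 0))"


section \<open>The embedding of the Weyl group\<close>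

definition P_fun ::
  "'s set \<Rightarrow> ('s \<Rightarrow> 's \<Rightarrow> int) \<Rightarrow> nat \<Rightarrow> 's \<Rightarrow> ('s \<times> int \<Rightarrow> real) \<Rightarrow> real" where
  "P_fun S e m s a =
     (\<Sum>j\<in>{0..<int m}. 1 / (a (s, j) * a (s, (j + 1) mod int m)) *
        (\<Prod>u\<in>S. a (u, j) ^ nat (- e s u) * a (u, (j + 1) mod int m) ^ nat (e s u)))"

text \<open>
  The second conjunct says that pulling back the initial cluster coordinates along the action of
  \<open>\<phi> r\<^sub>s\<close> multiplies those of row \<open>s\<close> by \<^const>\<open>P_fun\<close> and fixes the others. It determines \<open>\<phi>\<close>,
  because the action of the cluster modular group is faithful.
\<close>

definition weyl_embedding ::
  "'s set \<Rightarrow> ('s \<Rightarrow> 's \<Rightarrow> int) \<Rightarrow> ('s \<Rightarrow> 's \<Rightarrow> int) \<Rightarrow> nat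
     \<Rightarrow> ('s \<times> int, 'a::field_char_0, 'x::field_char_0) seed
     \<Rightarrow> ('s word set \<Rightarrow> ('s \<times> int, 'a, 'x) seed \<Rightarrow> ('s \<times> int, 'a, 'x) seed) \<Rightarrow> bool" where
  "weyl_embedding S C e m \<ii>\<^sub>0 \<phi> \<longleftrightarrow>
     (let I = Q_vertices S m; \<s> = mutation_class I \<ii>\<^sub>0 in
       \<phi> \<in> mon (weyl_group S C) (cluster_modular_group I \<s>) \<and>
       (\<forall>s\<in>S. \<forall>g\<in>cluster_manifold I \<s>. \<forall>u\<in>S. \<forall>j\<in>{0..<int m}.
          modular_action \<s> (\<phi> (weyl_generator S C s)) g \<ii>\<^sub>0 (u, j) =
            (if u = s then P_fun S e m s (g \<ii>\<^sub>0) * g \<ii>\<^sub>0 (u, j) else g \<ii>\<^sub>0 (u, j))))"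

end

theory Submission
  imports Defs
begin

text \<open>
  Take the points of the cluster manifold whose initial coordinates are constant along each row,
  \<open>A\<^sub>j\<^sup>s = exp (x s)\<close>. They are parametrised by the vectors \<open>x\<close> in the real vector space with basis \<open>S\<close>.
  The quiver is built so that on such a point every summand of \<open>P\<^sub>s\<close> has the same value
  \<open>exp (- (\<Sum>u. C u s * x u))\<close>: the factor \<open>1 / (A\<^sub>j\<^sup>s A\<^sub>j\<^sub>+\<^sub>1\<^sup>s)\<close> accounts for \<open>C s s = 2\<close>, the other factors
  for \<open>\<bar>e s u\<bar> = - C u s\<close>. Hence \<open>r\<^sub>s\<close> maps these points among themselves, and in the parameter \<open>x\<close>
  it is the affine map \<open>x s \<mapsto> x s + ln m - (\<Sum>u. C u s * x u)\<close>, a simple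
  reflection followed by a translation (\<open>P_fun_row_constant\<close>). So the whole Weyl group acts by affine maps on a real
  affine space, and a finite group acting by affine maps fixes the barycentre of each of its orbits.

  What remains is that every positive vector really is the initial coordinate vector of exactly one
  point. Uniqueness is clear, since each chart is computed from the previous one
  (\<open>cluster_manifold_point_unique\<close>). For existence (\<open>cluster_manifold_point_exists\<close>) the coordinates in
  another chart must not depend on the sequence of mutations that leads to it. They are obtained by
  evaluating the cluster variables themselves, which are quotients of polynomials in the initial ones:
  by algebraic independence the value of such an element of the field does not depend on how it is
  written, provided that numerator and denominator take positive values. This class of elements is
  closed under the subtraction-free operations, so it contains all cluster variables.
\<close>

section \<open>Evaluating subtraction-free expressions at a positive point\<close>

locale positive_evaluation =
  fixes I :: "'i set" and A :: "'i \<Rightarrow> 'f::field_char_0" and a :: "'i \<Rightarrow> real"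
  assumes finite_index: "finite I"
    and independent: "alg_independent I A"
    and positive: "\<And>i. i \<in> I \<Longrightarrow> 0 < a i"
begin

text \<open>
  The graph of the evaluation of rational polynomials at \<open>a\<close>, as a relation between elements of the field
  and real numbers. The monomials added need not be distinct, so that sums and products need no
  bookkeeping of supports.
\<close>

inductive poly_value :: "'f \<Rightarrow> real \<Rightarrow> bool" where
  zero: "poly_value 0 0"
| add_monomial: "poly_value x r \<Longrightarrow> n \<in> I \<rightarrow>\<^sub>E UNIV \<Longrightarrow>
    poly_value (x + of_rat q * (\<Prod>i\<in>I. A i ^ n i)) (r + of_rat q * (\<Prod>i\<in>I. a i ^ n i))"

lemma poly_value_monomial:
  "n \<in> I \<rightarrow>\<^sub>E UNIV \<Longrightarrow>
     poly_value (of_rat q * (\<Prod>i\<in>I. A i ^ n i)) (of_rat q * (\<Prod>i\<in>I. a i ^ n i))"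
  using add_monomial[OF zero, of n q] by simp

lemma poly_value_of_rat: "poly_value (of_rat q) (of_rat q)"
  using poly_value_monomial[of "\<lambda>j\<in>I. 0" q] by (simp cong: prod.cong)

lemma poly_value_generator:
  assumes "i \<in> I"
  shows "poly_value (A i) (a i)"
proof -
  define n :: "'i \<Rightarrow> nat" where "n = (\<lambda>j\<in>I. if j = i then 1 else 0)"
  have prod_n: "(\<Prod>j\<in>I. b j ^ n j) = b i" for b :: "'i \<Rightarrow> 'c::comm_monoid_mult"
  proof -
    have "(\<Prod>j\<in>I. b j ^ n j) = (\<Prod>j\<in>I. if j = i then b j else 1)"
      by (intro prod.cong) (auto simp: n_def)
    then show ?thesis
      using assms finite_index by simp
  qed
  have "n \<in> I \<rightarrow>\<^sub>E UNIV"
    by (auto simp: n_def)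
  then show ?thesis
    using poly_value_monomial[of n 1] by (simp add: prod_n)
qed

lemma poly_value_add: "poly_value y t \<Longrightarrow> poly_value x r \<Longrightarrow> poly_value (x + y) (r + t)"
proof (induction rule: poly_value.induct)
  case (add_monomial y t n q)
  then show ?case
    using poly_value.add_monomial[of "x + y" "r + t" n q] by (simp add: add.assoc)
qed simp

lemma poly_value_mult_monomial:
  assumes "poly_value x r" and n: "n \<in> I \<rightarrow>\<^sub>E UNIV"
  shows "poly_value (x * (of_rat q * (\<Prod>i\<in>I. A i ^ n i))) (r * (of_rat q * (\<Prod>i\<in>I. a i ^ n i)))"
  using assms(1)
proof (induction rule: poly_value.induct)
  case zero
  then show ?case
    by (simp add: poly_value.zero)
next
  case (add_monomial x r n' q')
  define k where "k = (\<lambda>i\<in>I. n' i + n i)"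
  have prod_k: "(\<Prod>i\<in>I. b i ^ k i) = (\<Prod>i\<in>I. b i ^ n' i) * (\<Prod>i\<in>I. b i ^ n i)"
    for b :: "'i \<Rightarrow> 'c::comm_monoid_mult"
    by (simp add: k_def power_add prod.distrib cong: prod.cong)
  have "k \<in> I \<rightarrow>\<^sub>E UNIV"
    by (auto simp: k_def)
  from poly_value.add_monomial[OF add_monomial.IH this, of "q' * q"] show ?case
    by (simp add: prod_k of_rat_mult algebra_simps)
qed

lemma poly_value_mult: "poly_value y t \<Longrightarrow> poly_value x r \<Longrightarrow> poly_value (x * y) (r * t)"
proof (induction rule: poly_value.induct)
  case zero
  then show ?case
    by (simp add: poly_value.zero)
next
  case (add_monomial y t n q)
  show ?case
    unfolding distrib_left
    by (intro poly_value_add poly_value_mult_monomial add_monomial)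
qed

lemma poly_value_diff: "poly_value x r \<Longrightarrow> poly_value y t \<Longrightarrow> poly_value (x - y) (r - t)"
  using poly_value_add[OF poly_value_mult[OF poly_value_of_rat[of "-1"]], of y t x r] by simp

text \<open>
  Collecting equal monomials brings a polynomial into the shape to which algebraic independence
  applies.
\<close>

lemma poly_value_normal_form:
  assumes "poly_value x r"
  shows "\<exists>N c. finite N \<and> N \<subseteq> I \<rightarrow>\<^sub>E UNIV \<and>
    x = (\<Sum>n\<in>N. of_rat (c n) * (\<Prod>i\<in>I. A i ^ n i)) \<and>
    r = (\<Sum>n\<in>N. of_rat (c n) * (\<Prod>i\<in>I. a i ^ n i))"
  using assms
proof (induction rule: poly_value.induct)
  case zero
  show ?case
    by (intro exI[of _ "{}"]) simp
next
  case (add_monomial x r n q)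
  then obtain N c where N: "finite N" "N \<subseteq> I \<rightarrow>\<^sub>E UNIV"
    and x: "x = (\<Sum>n\<in>N. of_rat (c n) * (\<Prod>i\<in>I. A i ^ n i))"
    and r: "r = (\<Sum>n\<in>N. of_rat (c n) * (\<Prod>i\<in>I. a i ^ n i))"
    by blast
  define c' where "c' = (\<lambda>k. (if k \<in> N then c k else 0) + (if k = n then q else 0))"
  have sum_c': "(\<Sum>k\<in>insert n N. of_rat (c' k) * w k) = (\<Sum>k\<in>N. of_rat (c k) * w k) + of_rat q * w n"
    for w :: "('i \<Rightarrow> nat) \<Rightarrow> 'c::field_char_0"
  proof -
    have "(\<Sum>k\<in>insert n N. of_rat (c' k) * w k) =
        (\<Sum>k\<in>insert n N. (if k \<in> N then of_rat (c k) * w k else 0) + (if k = n then of_rat q * w k else 0))"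
      by (intro sum.cong) (auto simp: c'_def of_rat_add algebra_simps)
    also have "\<dots> = (\<Sum>k\<in>insert n N. if k \<in> N then of_rat (c k) * w k else 0) + of_rat q * w n"
      using N(1) by (simp add: sum.distrib)
    also have "(\<Sum>k\<in>insert n N. if k \<in> N then of_rat (c k) * w k else 0) = (\<Sum>k\<in>N. of_rat (c k) * w k)"
      using N(1) by (intro sum.mono_neutral_cong_right) auto
    finally show ?thesis .
  qed
  show ?case
  proof (rule exI[of _ "insert n N"], rule exI[of _ c'], intro conjI)
    show "finite (insert n N)" "insert n N \<subseteq> I \<rightarrow>\<^sub>E UNIV"
      using N add_monomial.hyps by simp_all
  qed (simp_all only: sum_c' x r)
qed

text \<open>
  By algebraic independence, a polynomial that vanishes in the field has only zero coefficients. With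
  closure under differences this makes the evaluation single-valued.
\<close>

lemma poly_value_0_unique:
  assumes "poly_value 0 r"
  shows "r = 0"
proof -
  obtain N c where N: "finite N" "N \<subseteq> I \<rightarrow>\<^sub>E UNIV"
    and 0: "0 = (\<Sum>n\<in>N. of_rat (c n) * (\<Prod>i\<in>I. A i ^ n i))"
    and r: "r = (\<Sum>n\<in>N. of_rat (c n) * (\<Prod>i\<in>I. a i ^ n i))"
    using poly_value_normal_form[OF assms] by (elim exE conjE) (rule that)
  have "\<forall>n\<in>N. c n = 0"
    using independent[unfolded alg_independent_def, rule_format, OF N 0[symmetric]] by blast
  then show ?thesis
    by (simp add: r)
qed

text \<open>
  The numerator must be positive at \<open>a\<close> as well as the denominator, because mutation inverts cluster
  variables.
\<close>

definition pos_value :: "'f \<Rightarrow> real \<Rightarrow> bool" where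
  "pos_value x r \<longleftrightarrow> (\<exists>p t q s. poly_value p t \<and> poly_value q s \<and> 0 < t \<and> 0 < s \<and> x = p / q \<and> r = t / s)"

lemma pos_value_pos: "pos_value x r \<Longrightarrow> 0 < r"
  by (auto simp: pos_value_def)

text \<open>The denominators that occur do not vanish in the field, because they do not vanish at \<open>a\<close>.\<close>

lemma poly_value_nonzero: "poly_value p t \<Longrightarrow> 0 < t \<Longrightarrow> p \<noteq> 0"
  using poly_value_0_unique by fastforce

text \<open>
  If \<open>p / q = p' / q'\<close> then the polynomial \<open>p q' - p' q\<close> is zero in the field, hence zero at \<open>a\<close>.
\<close>

lemma pos_value_unique:
  assumes "pos_value x r" and "pos_value x r'"
  shows "r = r'"
proof -
  obtain p t q s where 1: "poly_value p t" "poly_value q s" "0 < t" "0 < s" "x = p / q" "r = t / s"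
    using assms(1) unfolding pos_value_def by blast
  obtain p' t' q' s' where 2: "poly_value p' t'" "poly_value q' s'" "0 < t'" "0 < s'"
      "x = p' / q'" "r' = t' / s'"
    using assms(2) unfolding pos_value_def by blast
  have "q \<noteq> 0" "q' \<noteq> 0"
    using 1(2,4) 2(2,4) poly_value_nonzero by blast+
  then have "p * q' - p' * q = 0"
    using 1(5) 2(5) by (simp add: frac_eq_eq)
  moreover have "poly_value (p * q' - p' * q) (t * s' - t' * s)"
    by (intro poly_value_diff poly_value_mult 1 2)
  ultimately have "t * s' - t' * s = 0"
    using poly_value_0_unique by metis
  then show ?thesis
    unfolding 1(6) 2(6) using 1(4) 2(4) by (simp add: frac_eq_eq)
qed

lemma pos_value_generator: "i \<in> I \<Longrightarrow> pos_value (A i) (a i)"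
  unfolding pos_value_def
  by (rule exI[of _ "A i"], rule exI[of _ "a i"], rule exI[of _ 1], rule exI[of _ 1])
    (use poly_value_generator positive poly_value_of_rat[of 1] in auto)

lemma pos_value_1: "pos_value 1 1"
  unfolding pos_value_def
  by (rule exI[of _ 1], rule exI[of _ 1], rule exI[of _ 1], rule exI[of _ 1])
    (use poly_value_of_rat[of 1] in auto)

lemma pos_value_inverse: "pos_value x r \<Longrightarrow> pos_value (inverse x) (inverse r)"
  unfolding pos_value_def by (metis inverse_divide)

lemma pos_value_mult: 
  assumes "pos_value x r" and "pos_value y u"
  shows "pos_value (x * y) (r * u)"
proof -
  obtain p t q s where 1: "poly_value p t" "poly_value q s" "0 < t" "0 < s" "x = p / q" "r = t / s"
    using assms(1) unfolding pos_value_def by blast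
  obtain p' t' q' s' where 2: "poly_value p' t'" "poly_value q' s'" "0 < t'" "0 < s'"
      "y = p' / q'" "u = t' / s'"
    using assms(2) unfolding pos_value_def by blast
  have "poly_value (p * p') (t * t')" "poly_value (q * q') (s * s')"
    by (intro poly_value_mult 1 2)+
  moreover have "0 < t * t'" "0 < s * s'"
    using 1 2 by simp_all
  moreover have "x * y = (p * p') / (q * q')" "r * u = (t * t') / (s * s')"
    using 1 2 by simp_all
  ultimately show ?thesis
    unfolding pos_value_def by blast
qed

lemma pos_value_add: 
  assumes "pos_value x r" and "pos_value y u"
  shows "pos_value (x + y) (r + u)"
proof -
  obtain p t q s where 1: "poly_value p t" "poly_value q s" "0 < t" "0 < s" "x = p / q" "r = t / s"
    using assms(1) unfolding pos_value_def by blast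
  obtain p' t' q' s' where 2: "poly_value p' t'" "poly_value q' s'" "0 < t'" "0 < s'"
      "y = p' / q'" "u = t' / s'"
    using assms(2) unfolding pos_value_def by blast
  have nz: "q \<noteq> 0" "q' \<noteq> 0"
    using 1(2,4) 2(2,4) poly_value_nonzero by blast+
  have "poly_value (p * q' + p' * q) (t * s' + t' * s)" "poly_value (q * q') (s * s')"
    by (intro poly_value_add poly_value_mult 1 2)+
  moreover have "0 < t * s' + t' * s" "0 < s * s'"
    using 1 2 by (simp_all add: add_pos_pos)
  moreover have "x + y = (p * q' + p' * q) / (q * q')" "r + u = (t * s' + t' * s) / (s * s')"
    using 1 2 nz by (simp_all add: add_frac_eq)
  ultimately show ?thesis
    unfolding pos_value_def by blast
qed

lemma pos_value_power: "pos_value x r \<Longrightarrow> pos_value (x ^ n) (r ^ n)"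
  by (induction n) (simp_all add: pos_value_1 pos_value_mult)

lemma pos_value_prod:
  "(\<And>j. j \<in> J \<Longrightarrow> pos_value (x j) (r j)) \<Longrightarrow> pos_value (\<Prod>j\<in>J. x j) (\<Prod>j\<in>J. r j)"
  by (induction J rule: infinite_finite_induct) (simp_all add: pos_value_1 pos_value_mult)

text \<open>The exchange relation is built from sums, products and inverses only.\<close>

lemma pos_value_mutate_A:
  assumes "\<And>j. j \<in> I \<Longrightarrow> pos_value (x j) (r j)" and "k \<in> I" and "i \<in> I"
  shows "pos_value (mutate_A I \<epsilon> k x i) (mutate_A I \<epsilon> k r i)"
  using assms
  by (auto simp: mutate_A_def
      intro!: pos_value_mult pos_value_add pos_value_inverse pos_value_prod pos_value_power)

end

section \<open>Points of the cluster manifold\<close>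

text \<open>
  The coordinates in the chart of a seed are the values of its cluster variables. Two mutation
  sequences that lead to the same seed produce the same field elements, hence the same coordinates.
\<close>

lemma cluster_manifold_point_exists:
  fixes \<ii>\<^sub>0 :: "('i, 'a::field_char_0, 'x::field_char_0) seed"
  assumes "finite I" and "alg_independent I (clA \<ii>\<^sub>0)" and a: "a \<in> I \<rightarrow>\<^sub>E {0<..}"
  shows "\<exists>g\<in>cluster_manifold I (mutation_class I \<ii>\<^sub>0). g \<ii>\<^sub>0 = a"
proof -
  interpret positive_evaluation I "clA \<ii>\<^sub>0" a
    using assms by unfold_locales auto
  let ?s = "mutation_class I \<ii>\<^sub>0"
  define g where "g = (\<lambda>\<ii>\<in>?s. \<lambda>j\<in>I. THE r. pos_value (clA \<ii> j) r)"
  have g_eqI: "g \<ii> = b"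
    if "\<ii> \<in> ?s" "b \<in> extensional I" "\<And>j. j \<in> I \<Longrightarrow> pos_value (clA \<ii> j) (b j)" for \<ii> b
    using that pos_value_unique
    by (intro extensionalityI[of _ I]) (auto simp: g_def intro!: the_equality)
  have ex: "\<forall>j\<in>I. \<exists>r. pos_value (clA \<ii> j) r" if "\<ii> \<in> ?s" for \<ii>
    using that
  proof (induction rule: mutation_class.induct)
    case base
    then show ?case
      using pos_value_generator by blast
  next
    case (mutate \<ii> k)
    then obtain r where "\<And>j. j \<in> I \<Longrightarrow> pos_value (clA \<ii> j) (r j)"
      by metis
    then show ?case
      using pos_value_mutate_A[of "clA \<ii>" r k _ "exch \<ii>"] mutate.hyps
      by (auto simp: Defs.mutate_def)
  next
    case (relabel \<ii> \<sigma>)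
    then show ?case
      by (simp add: Defs.relabel_def permutes_in_image)
  qed
  have g_value: "pos_value (clA \<ii> j) (g \<ii> j)" if \<ii>: "\<ii> \<in> ?s" and j: "j \<in> I" for \<ii> j
  proof -
    obtain r where "pos_value (clA \<ii> j) r"
      using ex \<ii> j by blast
    then show ?thesis
      using \<ii> j pos_value_unique by (auto simp: g_def intro: theI)
  qed
  have "g \<in> ?s \<rightarrow>\<^sub>E (I \<rightarrow>\<^sub>E {0<..})"
  proof (intro PiE_I)
    show "g \<ii> j \<in> {0<..}" if "\<ii> \<in> ?s" "j \<in> I" for \<ii> j
      using pos_value_pos[OF g_value[OF that]] by simp
  qed (simp_all add: g_def)
  moreover have "g (mutate I k \<ii>) = mutate_A I (exch \<ii>) k (g \<ii>)" if "\<ii> \<in> ?s" "k \<in> I" for \<ii> k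
  proof (rule g_eqI)
    show "mutate I k \<ii> \<in> ?s"
      using that by (rule mutation_class.mutate)
    show "mutate_A I (exch \<ii>) k (g \<ii>) \<in> extensional I"
      by (simp add: mutate_A_def)
    show "pos_value (clA (mutate I k \<ii>) j) (mutate_A I (exch \<ii>) k (g \<ii>) j)" if "j \<in> I" for j
      using pos_value_mutate_A[of "clA \<ii>" "g \<ii>"] g_value \<open>\<ii> \<in> ?s\<close> \<open>k \<in> I\<close> that
      by (simp add: Defs.mutate_def)
  qed
  moreover have "g (relabel \<sigma> \<ii>) = g \<ii> \<circ> \<sigma>" if "\<ii> \<in> ?s" "\<sigma> permutes I" for \<ii> \<sigma>
  proof (rule g_eqI)
    show "g \<ii> \<circ> \<sigma> \<in> extensional I"
      using that by (auto simp: g_def extensional_def permutes_not_in)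
    show "relabel \<sigma> \<ii> \<in> ?s"
      using that by (rule mutation_class.relabel)
  qed (use that g_value in \<open>simp add: Defs.relabel_def permutes_in_image\<close>)
  moreover have "g \<ii>\<^sub>0 = a"
    using a pos_value_generator by (intro g_eqI) (auto simp: PiE_def intro: mutation_class.base)
  ultimately show ?thesis
    unfolding cluster_manifold_def by blast
qed

lemma cluster_manifold_point_unique:
  assumes g: "g \<in> cluster_manifold I (mutation_class I \<ii>\<^sub>0)"
    and h: "h \<in> cluster_manifold I (mutation_class I \<ii>\<^sub>0)"
    and eq: "g \<ii>\<^sub>0 = h \<ii>\<^sub>0"
  shows "g = h"
proof (rule extensionalityI)
  show "g \<in> extensional (mutation_class I \<ii>\<^sub>0)" "h \<in> extensional (mutation_class I \<ii>\<^sub>0)"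
    using g h by (auto simp: cluster_manifold_def PiE_def)
  show "g \<ii> = h \<ii>" if "\<ii> \<in> mutation_class I \<ii>\<^sub>0" for \<ii>
    using that
    by (induction rule: mutation_class.induct) (use g h eq in \<open>auto simp: cluster_manifold_def\<close>)
qed

section \<open>The action of the cluster modular group\<close>

lemma cluster_modular_groupD:
  assumes "\<phi> \<in> carrier (cluster_modular_group I \<s>)"
  shows "\<phi> \<in> Bij \<s>" and "bij_betw \<phi> \<s> \<s>"
    and "\<And>\<ii>. \<ii> \<in> \<s> \<Longrightarrow> exch (\<phi> \<ii>) = exch \<ii>"
    and "\<And>\<ii> k. \<ii> \<in> \<s> \<Longrightarrow> k \<in> I \<Longrightarrow> \<phi> (mutate I k \<ii>) = mutate I k (\<phi> \<ii>)"
    and "\<And>\<ii> \<sigma>. \<ii> \<in> \<s> \<Longrightarrow> \<sigma> permutes I \<Longrightarrow> \<phi> (relabel \<sigma> \<ii>) = relabel \<sigma> (\<phi> \<ii>)"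
  using assms by (auto simp: cluster_modular_group_def Bij_def)

text \<open>
  Evaluating at \<open>\<phi> \<ii>\<close> rather than at \<open>\<ii>\<close> removes the inverse from the definition of the action; every seed
  is of this form.
\<close>

lemma modular_action_image:
  assumes "bij_betw \<phi> \<s> \<s>" and "\<ii> \<in> \<s>"
  shows "modular_action \<s> \<phi> g (\<phi> \<ii>) = g \<ii>"
  using assms by (auto simp: modular_action_def bij_betw_def)

lemma modular_action_closed:
  assumes \<phi>: "\<phi> \<in> carrier (cluster_modular_group I (mutation_class I \<ii>\<^sub>0))"
    and g: "g \<in> cluster_manifold I (mutation_class I \<ii>\<^sub>0)"
  shows "modular_action (mutation_class I \<ii>\<^sub>0) \<phi> g \<in> cluster_manifold I (mutation_class I \<ii>\<^sub>0)"
proof -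
  let ?s = "mutation_class I \<ii>\<^sub>0"
  let ?h = "modular_action ?s \<phi> g"
  note \<phi>_props = cluster_modular_groupD[OF \<phi>]
  note image = modular_action_image[OF \<phi>_props(2), of _ g]
  have inv: "inv_into ?s \<phi> \<ii> \<in> ?s" if "\<ii> \<in> ?s" for \<ii>
    using that \<phi>_props(2) by (metis bij_betw_def inv_into_into)
  have "?h \<in> ?s \<rightarrow>\<^sub>E (I \<rightarrow>\<^sub>E {0<..})"
    using g inv by (auto simp: modular_action_def cluster_manifold_def PiE_iff)
  moreover have "?h (mutate I k \<ii>) = mutate_A I (exch \<ii>) k (?h \<ii>)"
    if "\<ii> \<in> ?s" "k \<in> I" for \<ii> k
  proof -
    obtain \<jj> where "\<jj> \<in> ?s" "\<ii> = \<phi> \<jj>"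
      using \<open>\<ii> \<in> ?s\<close> \<phi>_props(2) by (auto simp: bij_betw_def)
    then show ?thesis
      using that g image[of "mutate I k \<jj>"] image[of \<jj>] \<phi>_props(3,4)[of \<jj>] mutation_class.mutate[of \<jj>]
      by (simp add: cluster_manifold_def)
  qed
  moreover have "?h (relabel \<sigma> \<ii>) = ?h \<ii> \<circ> \<sigma>" if "\<ii> \<in> ?s" "\<sigma> permutes I" for \<ii> \<sigma>
  proof -
    obtain \<jj> where "\<jj> \<in> ?s" "\<ii> = \<phi> \<jj>"
      using \<open>\<ii> \<in> ?s\<close> \<phi>_props(2) by (auto simp: bij_betw_def)
    then show ?thesis
      using that g image[of "relabel \<sigma> \<jj>"] image[of \<jj>] \<phi>_props(5)[of \<jj>] mutation_class.relabel[of \<jj>]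
      by (simp add: cluster_manifold_def)
  qed
  ultimately show ?thesis
    by (simp add: cluster_manifold_def)
qed

lemma modular_action_mult:
  assumes "\<phi> \<in> carrier (cluster_modular_group I \<s>)" and "\<psi> \<in> carrier (cluster_modular_group I \<s>)"
  shows "modular_action \<s> (\<phi> \<otimes>\<^bsub>cluster_modular_group I \<s>\<^esub> \<psi>) g =
    modular_action \<s> \<phi> (modular_action \<s> \<psi> g)"
proof (rule extensionalityI[of _ \<s>])
  note \<phi> = cluster_modular_groupD[OF assms(1)] and \<psi> = cluster_modular_groupD[OF assms(2)]
  have mult: "\<phi> \<otimes>\<^bsub>cluster_modular_group I \<s>\<^esub> \<psi> = compose \<s> \<phi> \<psi>"
    using \<phi>(1) \<psi>(1) by (simp add: cluster_modular_group_def BijGroup_def)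
  have bij: "bij_betw (compose \<s> \<phi> \<psi>) \<s> \<s>"
    using compose_Bij[OF \<phi>(1) \<psi>(1)] by (simp add: Bij_def)
  fix \<ii> assume "\<ii> \<in> \<s>"
  then obtain \<jj> where \<jj>: "\<jj> \<in> \<s>" "\<ii> = compose \<s> \<phi> \<psi> \<jj>"
    using bij by (auto simp: bij_betw_def)
  then have "\<ii> = \<phi> (\<psi> \<jj>)" "\<psi> \<jj> \<in> \<s>"
    using \<psi>(2) by (auto simp: compose_def bij_betw_def)
  then show "modular_action \<s> (\<phi> \<otimes>\<^bsub>cluster_modular_group I \<s>\<^esub> \<psi>) g \<ii> =
      modular_action \<s> \<phi> (modular_action \<s> \<psi> g) \<ii>"
    unfolding mult using modular_action_image[OF bij, of \<jj> g] \<jj>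
      modular_action_image[OF \<phi>(2), of "\<psi> \<jj>"] modular_action_image[OF \<psi>(2), of \<jj> g]
    by simp
qed (simp_all add: modular_action_def)

text \<open>
  Applied to the image of the unit of the Weyl group: being a homomorphism makes it idempotent, and an
  idempotent bijection is the identity.
\<close>

lemma modular_action_idempotent:
  assumes "\<phi> \<in> carrier (cluster_modular_group I \<s>)"
    and "\<phi> \<otimes>\<^bsub>cluster_modular_group I \<s>\<^esub> \<phi> = \<phi>"
    and "g \<in> extensional \<s>"
  shows "modular_action \<s> \<phi> g = g"
proof (rule extensionalityI[of _ \<s>])
  note \<phi> = cluster_modular_groupD[OF assms(1)]
  fix \<ii> assume \<ii>: "\<ii> \<in> \<s>"
  have "compose \<s> \<phi> \<phi> = \<phi>"
    using assms(2) \<phi>(1) by (simp add: cluster_modular_group_def BijGroup_def)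
  then have "\<phi> (\<phi> \<ii>) = \<phi> \<ii>"
    using \<ii> by (metis compose_eq)
  then have "\<phi> \<ii> = \<ii>"
    using \<phi>(2) \<ii> by (auto simp: bij_betw_def dest: inj_onD)
  then show "modular_action \<s> \<phi> g \<ii> = g \<ii>"
    using modular_action_image[OF \<phi>(2) \<ii>, of g] by simp
qed (use assms(3) in \<open>simp_all add: modular_action_def\<close>)

lemma mult_left_inj_on_cluster_modular_group:
  assumes "\<phi> \<in> carrier (cluster_modular_group I \<s>)"
  shows "inj_on (mult (cluster_modular_group I \<s>) \<phi>) (carrier (cluster_modular_group I \<s>))"
proof (rule inj_onI)
  fix \<psi> \<chi>
  assume \<psi>: "\<psi> \<in> carrier (cluster_modular_group I \<s>)" and \<chi>: "\<chi> \<in> carrier (cluster_modular_group I \<s>)"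
    and eq: "\<phi> \<otimes>\<^bsub>cluster_modular_group I \<s>\<^esub> \<psi> = \<phi> \<otimes>\<^bsub>cluster_modular_group I \<s>\<^esub> \<chi>"
  note Bij = cluster_modular_groupD(1)[OF assms] cluster_modular_groupD(1)[OF \<psi>]
    cluster_modular_groupD(1)[OF \<chi>]
  have "\<phi> \<otimes>\<^bsub>BijGroup \<s>\<^esub> \<psi> = \<phi> \<otimes>\<^bsub>BijGroup \<s>\<^esub> \<chi>"
    using eq by (simp add: cluster_modular_group_def)
  moreover have "\<phi> \<in> carrier (BijGroup \<s>)" "\<psi> \<in> carrier (BijGroup \<s>)" "\<chi> \<in> carrier (BijGroup \<s>)"
    using Bij by (simp_all add: BijGroup_def)
  ultimately show "\<psi> = \<chi>"
    using monoid.Units_l_cancel[OF group.is_monoid] group.Units_eq group_BijGroup by metis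
qed

section \<open>Products of generators\<close>

lemma word_class_mult:
  assumes "v \<in> lists (S \<times> UNIV)" and "w \<in> lists (S \<times> UNIV)"
  shows "word_class S R v \<otimes>\<^bsub>presented_group S R\<^esub> word_class S R w = word_class S R (v @ w)"
  using assms
  by (auto simp: presented_group_def word_class_def intro: pres_eq.intros)

lemma word_class_eqI: "pres_eq S R v w \<Longrightarrow> word_class S R v = word_class S R w"
  by (auto simp: word_class_def intro: pres_eq.intros)

lemma word_class_inverse_generator:
  assumes "s \<in> S" and "[(s, True), (s, True)] \<in> R"
  shows "word_class S R [(s, False)] = word_class S R [(s, True)]"
proof (rule word_class_eqI)
  have F: "pres_eq S R [(s, False)] [(s, False)]" and T: "pres_eq S R [(s, True)] [(s, True)]"
    using assms by (auto intro: pres_eq.refl)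
  have "pres_eq S R ([(s, False)] @ [(s, True), (s, True)]) ([(s, False)] @ [])"
    by (intro pres_eq.append F pres_eq.relator assms)
  moreover have "pres_eq S R ([(s, False), (s, True)] @ [(s, True)]) ([] @ [(s, True)])"
    using pres_eq.cancel[OF assms(1), of R False] by (intro pres_eq.append T) auto
  ultimately show "pres_eq S R [(s, False)] [(s, True)]"
    using pres_eq.sym pres_eq.trans by fastforce
qed

text \<open>
  The generators are involutions, so induction over words without formal inverses reaches every
  element.
\<close>

lemma weyl_group_induct [consumes 1, case_names one gen_mult]:
  assumes "w \<in> carrier (weyl_group S C)"
    and "P \<one>\<^bsub>weyl_group S C\<^esub>"
    and "\<And>s w. s \<in> S \<Longrightarrow> w \<in> carrier (weyl_group S C) \<Longrightarrow> P w \<Longrightarrow>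
      P (weyl_generator S C s \<otimes>\<^bsub>weyl_group S C\<^esub> w)"
  shows "P w"
proof -
  let ?R = "weyl_relators S C"
  have *: "P (word_class S ?R v)" if "v \<in> lists (S \<times> UNIV)" for v
    using that
  proof (induction v)
    case Nil
    then show ?case
      using assms(2) by (simp add: weyl_group_def presented_group_def)
  next
    case (Cons x v)
    then obtain s b where x: "x = (s, b)" "s \<in> S" and v: "v \<in> lists (S \<times> UNIV)"
      by auto
    have "[(s, True), (s, True)] \<in> ?R"
      using x(2) unfolding weyl_relators_def
      by (intro CollectI exI[of _ 1] exI[of _ s]) (simp add: coxeter_exponent_def one_enat_def)
    then have "word_class S ?R [(s, b)] = weyl_generator S C s"
      using word_class_inverse_generator[OF x(2)] by (cases b) (simp_all add: weyl_generator_def)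
    moreover have "word_class S ?R (x # v) = word_class S ?R [(s, b)] \<otimes>\<^bsub>weyl_group S C\<^esub> word_class S ?R v"
      using x v word_class_mult[of "[(s, b)]" S v ?R] by (simp add: weyl_group_def)
    moreover have "word_class S ?R v \<in> carrier (weyl_group S C)"
      using v by (simp add: weyl_group_def presented_group_def)
    ultimately show ?case
      using assms(3)[OF x(2)] Cons.IH v by simp
  qed
  then show ?thesis
    using assms(1) by (auto simp: weyl_group_def presented_group_def)
qed

lemma weyl_generator_in_carrier: "s \<in> S \<Longrightarrow> weyl_generator S C s \<in> carrier (weyl_group S C)"
  by (auto simp: weyl_generator_def weyl_group_def presented_group_def)

section \<open>The Weyl group acts by affine maps on points with constant rows\<close>

definition row_constant :: "'s set \<Rightarrow> nat \<Rightarrow> ('s \<Rightarrow> real) \<Rightarrow> 's \<times> int \<Rightarrow> real" where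
  "row_constant S m x = (\<lambda>v\<in>Q_vertices S m. exp (x (fst v)))"

text \<open>
  The linear part negates the \<open>s\<close>-th basis vector, because \<open>C s s = 2\<close>: it is the simple reflection at \<open>s\<close>
  for the transpose of \<open>C\<close>. The translation by \<open>ln m\<close> comes from the \<open>m\<close> equal
  summands of \<open>P\<^sub>s\<close>.
\<close>

definition affine_reflection ::
  "'s set \<Rightarrow> ('s \<Rightarrow> 's \<Rightarrow> int) \<Rightarrow> nat \<Rightarrow> 's \<Rightarrow> ('s \<Rightarrow> real) \<Rightarrow> 's \<Rightarrow> real" where
  "affine_reflection S C m s x = x(s := x s + (ln m - (\<Sum>u\<in>S. C u s * x u)))"

text \<open>
  In the summand with index \<open>j\<close> the exponents of \<open>A\<^sub>j\<^sup>u\<close> and \<open>A\<^sub>j\<^sub>+\<^sub>1\<^sup>u\<close> add up to \<open>\<bar>e s u\<bar> = - C u s\<close> for \<open>u \<noteq> s\<close>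
  and to \<open>- 2 = - C s s\<close> for \<open>u = s\<close>. On constant rows only these sums matter.
\<close>

lemma P_fun_row_constant:
  assumes "finite S" and "symmetrizable_gcm S C" and "coxeter_quiver S C e" and "m > 0" and "s \<in> S"
  shows "P_fun S e m s (row_constant S m x) = exp (ln m - (\<Sum>u\<in>S. C u s * x u))"
proof -
  let ?a = "row_constant S m x"
  have a: "?a (u, j) = exp (x u)" if "u \<in> S" "j \<in> {0..<int m}" for u j
    using that by (simp add: row_constant_def Q_vertices_def)
  (* The 2 for u = s compensates the denominator of the summand, which is treated separately. *)
  have abs_e: "real (nat (- e s u)) + real (nat (e s u)) = (if u = s then 2 else 0) - C u s" if "u \<in> S" for u
  proof (cases "u = s")
    case True
    then show ?thesis
      using assms by (simp add: coxeter_quiver_def symmetrizable_gcm_def)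
  next
    case False
    then have "\<bar>e s u\<bar> = - C u s"
      using assms that by (auto simp: coxeter_quiver_def)
    moreover have "real (nat (- e s u)) + real (nat (e s u)) = real_of_int \<bar>e s u\<bar>"
      by (cases "0 \<le> e s u") simp_all
    ultimately show ?thesis
      using False by simp
  qed
  have "1 / (?a (s, j) * ?a (s, (j + 1) mod int m)) *
        (\<Prod>u\<in>S. ?a (u, j) ^ nat (- e s u) * ?a (u, (j + 1) mod int m) ^ nat (e s u))
      = exp (- (\<Sum>u\<in>S. C u s * x u))" (is "?l = _") if j: "j \<in> {0..<int m}" for j
  proof -
    have j': "(j + 1) mod int m \<in> {0..<int m}"
      using \<open>m > 0\<close> by simp
    have "(\<Prod>u\<in>S. ?a (u, j) ^ nat (- e s u) * ?a (u, (j + 1) mod int m) ^ nat (e s u)) =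
        (\<Prod>u\<in>S. exp ((if u = s then 2 * x u else 0) - C u s * x u))"
    proof (rule prod.cong)
      fix u assume u: "u \<in> S"
      have "?a (u, j) ^ nat (- e s u) * ?a (u, (j + 1) mod int m) ^ nat (e s u) =
          exp ((real (nat (- e s u)) + real (nat (e s u))) * x u)"
        using u j j' by (simp add: a exp_of_nat_mult exp_add distrib_right)
      then show "?a (u, j) ^ nat (- e s u) * ?a (u, (j + 1) mod int m) ^ nat (e s u) =
          exp ((if u = s then 2 * x u else 0) - C u s * x u)"
        unfolding abs_e[OF u] by (simp add: left_diff_distrib)
    qed simp
    also have "\<dots> = exp (2 * x s - (\<Sum>u\<in>S. C u s * x u))"
      using assms(1,5) by (simp add: exp_sum[symmetric] sum_subtractf)
    finally show ?thesis
      using j j' assms(5) by (simp add: a exp_diff exp_minus field_simps flip: exp_add)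
  qed
  then have "P_fun S e m s ?a = (\<Sum>j\<in>{0..<int m}. exp (- (\<Sum>u\<in>S. C u s * x u)))"
    unfolding P_fun_def by (intro sum.cong) auto
  then show ?thesis
    using \<open>m > 0\<close> by (simp add: exp_diff exp_minus field_simps)
qed

text \<open>
  Compatibility with the barycentre of a family indexed by \<open>G\<close>: the form in which affinity enters.
\<close>

definition preserves_mean :: "'k set \<Rightarrow> (('s \<Rightarrow> real) \<Rightarrow> 's \<Rightarrow> real) \<Rightarrow> bool" where
  "preserves_mean G f \<longleftrightarrow> (\<forall>x :: 'k \<Rightarrow> 's \<Rightarrow> real.
     f (\<lambda>u. (\<Sum>k\<in>G. x k u) / card G) = (\<lambda>u. (\<Sum>k\<in>G. f (x k) u) / card G))"

lemma preserves_mean_comp: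
  "preserves_mean G f \<Longrightarrow> preserves_mean G f' \<Longrightarrow> preserves_mean G (\<lambda>x. f (f' x))"
  by (simp add: preserves_mean_def)

lemma preserves_mean_affine_reflection:
  fixes S :: "'s set" and G :: "'k set"
  assumes "finite G" and "G \<noteq> {}"
  shows "preserves_mean G (affine_reflection S C m s)"
  unfolding preserves_mean_def
proof (intro allI ext)
  fix x :: "'k \<Rightarrow> 's \<Rightarrow> real" and v
  have G: "real (card G) \<noteq> 0"
    using assms by simp
  have "(\<Sum>u\<in>S. C u s * ((\<Sum>k\<in>G. x k u) / card G)) = (\<Sum>k\<in>G. \<Sum>u\<in>S. C u s * x k u) / card G"
    by (subst sum.swap) (simp add: sum_distrib_left sum_divide_distrib)
  then show "affine_reflection S C m s (\<lambda>u. (\<Sum>k\<in>G. x k u) / card G) v =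
      (\<Sum>k\<in>G. affine_reflection S C m s (x k) v) / card G"
    using G by (simp add: affine_reflection_def sum.distrib sum_subtractf add_divide_distrib diff_divide_distrib)
qed

section \<open>The fixed point\<close>

theorem theorem4:
  fixes S :: "'s set" and C e :: "'s \<Rightarrow> 's \<Rightarrow> int" and m :: nat
    and d :: "'s \<times> int \<Rightarrow> nat"
    and \<ii>\<^sub>0 :: "('s \<times> int, 'a::field_char_0, 'x::field_char_0) seed"
    and \<phi> :: "'s word set \<Rightarrow> ('s \<times> int, 'a, 'x) seed \<Rightarrow> ('s \<times> int, 'a, 'x) seed"
    and G :: "'s word set set"
  assumes "finite S" and "symmetrizable_gcm S C" and "coxeter_quiver S C e" and "m \<ge> 2"
    and "\<forall>v\<in>Q_vertices S m. d v > 0"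
    and "is_seed (Q_vertices S m) d \<ii>\<^sub>0" and "exch \<ii>\<^sub>0 = Q_exch S e m"
    and "weyl_embedding S C e m \<ii>\<^sub>0 \<phi>"
    and "subgroup G (weyl_group S C)" and "finite G"
  shows "\<exists>g\<in>cluster_manifold (Q_vertices S m) (mutation_class (Q_vertices S m) \<ii>\<^sub>0).
           \<forall>\<gamma>\<in>\<phi> ` G. modular_action (mutation_class (Q_vertices S m) \<ii>\<^sub>0) \<gamma> g = g"
proof -
  let ?I = "Q_vertices S m"
  let ?s = "mutation_class ?I \<ii>\<^sub>0"
  let ?M = "cluster_manifold ?I ?s"
  let ?W = "weyl_group S C"
  let ?\<Gamma> = "cluster_modular_group ?I ?s"
  let ?T = "\<lambda>w. modular_action ?s (\<phi> w)"
  have "m > 0"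
    using \<open>m \<ge> 2\<close> by simp
  have hom: "\<phi> \<in> hom ?W ?\<Gamma>" and inj: "inj_on \<phi> (carrier ?W)"
    and gen: "\<And>s g u j. s \<in> S \<Longrightarrow> g \<in> ?M \<Longrightarrow> u \<in> S \<Longrightarrow> j \<in> {0..<int m} \<Longrightarrow>
      ?T (weyl_generator S C s) g \<ii>\<^sub>0 (u, j) =
        (if u = s then P_fun S e m s (g \<ii>\<^sub>0) * g \<ii>\<^sub>0 (u, j) else g \<ii>\<^sub>0 (u, j))"
    using assms(8) by (simp_all add: weyl_embedding_def mon_def Let_def)
  note \<phi>_closed = hom_in_carrier[OF hom] and \<phi>_mult = hom_mult[OF hom]
  have T_closed: "?T w g \<in> ?M" if "w \<in> carrier ?W" "g \<in> ?M" for w g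
    by (intro modular_action_closed \<phi>_closed that)
  have T_mult: "?T (v \<otimes>\<^bsub>?W\<^esub> w) g = ?T v (?T w g)" if "v \<in> carrier ?W" "w \<in> carrier ?W" for v w g
    using that by (simp add: \<phi>_mult modular_action_mult[OF \<phi>_closed \<phi>_closed])
  have "finite ?I"
    using assms(1) by (simp add: Q_vertices_def)
  moreover have "alg_independent ?I (clA \<ii>\<^sub>0)"
    using assms(6) by (simp add: is_seed_def free_generators_def)
  moreover have "row_constant S m x \<in> ?I \<rightarrow>\<^sub>E {0<..}" for x
    by (auto simp: row_constant_def)
  ultimately have "\<exists>g\<in>?M. g \<ii>\<^sub>0 = row_constant S m x" for x
    by (intro cluster_manifold_point_exists)
  then obtain pt where pt: "pt x \<in> ?M" "pt x \<ii>\<^sub>0 = row_constant S m x" for x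
    by metis
  have pt_eq_iff: "pt x = pt y \<longleftrightarrow> (\<forall>u\<in>S. x u = y u)" for x y
  proof
    assume "pt x = pt y"
    then have eq: "row_constant S m x (u, 0) = row_constant S m y (u, 0)" for u
      using pt(2) by metis
    show "\<forall>u\<in>S. x u = y u"
    proof
      fix u assume "u \<in> S"
      then show "x u = y u"
        using eq[of u] \<open>m > 0\<close> by (simp add: row_constant_def Q_vertices_def)
    qed
  next
    assume "\<forall>u\<in>S. x u = y u"
    then have "row_constant S m x = row_constant S m y"
      by (auto simp: row_constant_def Q_vertices_def)
    then show "pt x = pt y"
      using cluster_manifold_point_unique[OF pt(1) pt(1)] pt(2) by metis
  qed
  have T_gen: "?T (weyl_generator S C s) (pt x) = pt (affine_reflection S C m s x)" if "s \<in> S" for s x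
  proof (rule cluster_manifold_point_unique)
    show "?T (weyl_generator S C s) (pt x) \<in> ?M"
      by (intro T_closed weyl_generator_in_carrier pt that)
    show "?T (weyl_generator S C s) (pt x) \<ii>\<^sub>0 = pt (affine_reflection S C m s x) \<ii>\<^sub>0"
    proof (rule extensionalityI[of _ ?I])
      show "?T (weyl_generator S C s) (pt x) \<ii>\<^sub>0 \<in> extensional ?I"
        using \<open>?T (weyl_generator S C s) (pt x) \<in> ?M\<close> mutation_class.base[of \<ii>\<^sub>0 ?I]
        unfolding cluster_manifold_def PiE_def Pi_def by auto
      fix v assume v: "v \<in> ?I"
      then have coord: "row_constant S m y v = exp (y (fst v))" for y
        by (simp add: row_constant_def)
      have "?T (weyl_generator S C s) (pt x) \<ii>\<^sub>0 v =
          (if fst v = s then P_fun S e m s (pt x \<ii>\<^sub>0) * pt x \<ii>\<^sub>0 v else pt x \<ii>\<^sub>0 v)"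
        using gen[OF that pt(1), of "fst v" "snd v"] v by (cases v) (auto simp: Q_vertices_def)
      also have "\<dots> = exp (affine_reflection S C m s x (fst v))"
        by (simp add: pt(2) P_fun_row_constant[OF assms(1-3) \<open>m > 0\<close> that] coord
            affine_reflection_def exp_add)
      finally show "?T (weyl_generator S C s) (pt x) \<ii>\<^sub>0 v = pt (affine_reflection S C m s x) \<ii>\<^sub>0 v"
        by (simp add: pt(2) coord)
    qed (simp add: pt(2) row_constant_def)
  qed (rule pt)
  have "G \<subseteq> carrier ?W" "\<one>\<^bsub>?W\<^esub> \<in> G" and G_mult: "\<And>v w. v \<in> G \<Longrightarrow> w \<in> G \<Longrightarrow> v \<otimes>\<^bsub>?W\<^esub> w \<in> G"
    using assms(9) by (simp_all add: subgroup_def)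
  then have "G \<noteq> {}" and G: "\<And>w. w \<in> G \<Longrightarrow> w \<in> carrier ?W"
    by auto
  (* Each element acts through a product of affine reflections. The values of this map are determined
     by the element only on S, so the identities between these maps are stated for arguments in S. *)
  have "\<exists>f. preserves_mean G f \<and> (\<forall>x. ?T w (pt x) = pt (f x))" if "w \<in> carrier ?W" for w
    using that
  proof (induction rule: weyl_group_induct)
    case one
    have "\<one>\<^bsub>?W\<^esub> \<otimes>\<^bsub>?W\<^esub> \<one>\<^bsub>?W\<^esub> = \<one>\<^bsub>?W\<^esub>"
      using word_class_mult[of "[]" S "[]" "weyl_relators S C"]
      by (simp add: weyl_group_def presented_group_def)
    moreover have "\<one>\<^bsub>?W\<^esub> \<in> carrier ?W"
      by (intro G) fact
    ultimately have "\<phi> \<one>\<^bsub>?W\<^esub> \<otimes>\<^bsub>?\<Gamma>\<^esub> \<phi> \<one>\<^bsub>?W\<^esub> = \<phi> \<one>\<^bsub>?W\<^esub>" "\<phi> \<one>\<^bsub>?W\<^esub> \<in> carrier ?\<Gamma>"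
      using \<phi>_mult \<phi>_closed by metis+
    moreover have "pt x \<in> extensional ?s" for x
      using pt(1)[of x] by (auto simp: cluster_manifold_def PiE_def)
    ultimately have "?T \<one>\<^bsub>?W\<^esub> (pt x) = pt x" for x
      by (intro modular_action_idempotent)
    then show ?case
      by (intro exI[of _ "\<lambda>x. x"]) (simp add: preserves_mean_def)
  next
    case (gen_mult s w)
    then obtain f where "preserves_mean G f" "\<And>x. ?T w (pt x) = pt (f x)"
      by blast
    then show ?case
      using gen_mult.hyps \<open>G \<noteq> {}\<close> assms(10)
      by (intro exI[of _ "\<lambda>x. affine_reflection S C m s (f x)"])
        (simp add: preserves_mean_comp preserves_mean_affine_reflection T_mult T_gen
          weyl_generator_in_carrier)
  qed
  then obtain f where f_mean: "\<And>w. w \<in> carrier ?W \<Longrightarrow> preserves_mean G (f w)"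
    and f: "\<And>w x. w \<in> carrier ?W \<Longrightarrow> ?T w (pt x) = pt (f w x)"
    by metis
  (* The barycentre of the orbit of the point all of whose initial coordinates are 1. *)
  define b where "b = (\<lambda>u. (\<Sum>w\<in>G. f w (\<lambda>_. 0) u) / card G)"
  have "?T h (pt b) = pt b" if h: "h \<in> G" for h
  proof -
    (* Left translation by h permutes G; injectivity is transported from the group of bijections. *)
    have "inj_on (mult ?W h) G"
    proof (rule inj_onI)
      fix v w assume vw: "v \<in> G" "w \<in> G" and "h \<otimes>\<^bsub>?W\<^esub> v = h \<otimes>\<^bsub>?W\<^esub> w"
      then have "\<phi> h \<otimes>\<^bsub>?\<Gamma>\<^esub> \<phi> v = \<phi> h \<otimes>\<^bsub>?\<Gamma>\<^esub> \<phi> w"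
        using G h \<phi>_mult by metis
      then have "\<phi> v = \<phi> w"
        using mult_left_inj_on_cluster_modular_group[OF \<phi>_closed[OF G[OF h]]] \<phi>_closed G vw
        by (simp add: inj_on_def)
      then show "v = w"
        using inj G vw by (auto dest: inj_onD)
    qed
    then have perm: "bij_betw (mult ?W h) G G"
      using G_mult[OF h] assms(10) by (simp add: bij_betw_def endo_inj_surj image_subsetI)
    have f_mult: "f h (f w (\<lambda>_. 0)) u = f (h \<otimes>\<^bsub>?W\<^esub> w) (\<lambda>_. 0) u" if "w \<in> G" "u \<in> S" for w u
    proof -
      have "pt (f h (f w (\<lambda>_. 0))) = pt (f (h \<otimes>\<^bsub>?W\<^esub> w) (\<lambda>_. 0))"
        using T_mult f G G_mult h that(1) by metis
      then show ?thesis
        using pt_eq_iff that(2) by blast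
    qed
    have "f h b u = b u" if "u \<in> S" for u
    proof -
      have "f h b u = (\<Sum>w\<in>G. f h (f w (\<lambda>_. 0)) u) / card G"
        using f_mean[OF G[OF h]] by (simp add: preserves_mean_def b_def)
      also have "\<dots> = (\<Sum>w\<in>G. f (h \<otimes>\<^bsub>?W\<^esub> w) (\<lambda>_. 0) u) / card G"
        using f_mult that by (simp cong: sum.cong)
      also have "\<dots> = b u"
        unfolding b_def using sum.reindex_bij_betw[OF perm, of "\<lambda>w. f w (\<lambda>_. 0) u"] by simp
      finally show ?thesis .
    qed
    then have "pt (f h b) = pt b"
      using pt_eq_iff by blast
    then show ?thesis
      using f G h by simp
  qed
  then show ?thesis
    using pt(1) by blast
qed

end
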